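(* Fix an integer $s\ge 1$ and a real $\beta$ with $1-\frac{1}{2s}\le\beta\le 1$. Then $I(D(s),\beta)=\beta^{2s}(1-\beta)$, and equality holds for asymptotically regular graphs: every asymptotically regular sequence $(G_n)$ of density $\beta$ is $D(s)$-good with $\rho(D(s),(G_n))=\beta^{2s}(1-\beta)$. Moreover, $\max(D(s))=(2s)^{2s}\cdot(2s+1)^{-2s-1}$.
   Context: A red/blue graph $H$ is a graph each of whose edges is colored red or blue (other pairs of vertices are unspecified). A red/blue clique $G$ is a complete graph each of whose edges is colored red or blue. For a red/blue graph $H$ with $h$ vertices and a red/blue clique $G$, $(\#H,G)$ denotes the number of injections $f:V(H)\to V(G)$ such that for every $uv\in E(H)$, the edge $f(u)f(v)$ of $G$ has the same color as $uv$. Define $\max(H,n)$ as the maximum of $(\#H,G)$ over all red/blue cliques $G$ on $n$ vertices, and $\max(H)=\lim_{n\to\infty}\max(H,n)/n^h$. A sequence $(G_n)_{n\ge 1}$ of red/blue cliques has density $\beta$ if $|V(G_n)|=n$ and the proportion of edges of $G_n$ that are red tends to $\beta$. The sequence is $H$-good if $\rho(H,(G_n)):=\lim_{n\to\infty}(\#H,G_n)/n^h$ exists. $I(H,\beta)$ is the supremum of $\rho(H,(G_n))$ over all $H$-good sequences $(G_n)$ with density $\beta$. $D(s)$ is the alternating double star on $2s+2$ vertices $v_1,\dots,v_s,v,u,u_1,\dots,u_s$, with red edges $v_1v,\dots,v_sv,uu_1,\dots,uu_s$, blue edge $uv$, and no other edges. A sequence $(G_n)$ of density $\beta$ is asymptotically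 regular if for every $\varepsilon>0$ and all sufficiently large $n$, all but at most $\varepsilon n$ vertices of $G_n$ have red degree in $[(\beta-\varepsilon)n,(\beta+\varepsilon)n]$. *)

theory Defs
  imports Complex_Main "HOL-Library.FuncSet"
begin

record 'a rb_graph =
  verts :: "'a set"
  red :: "'a set set"
  blue :: "'a set set"

definition pairs :: "'a set \<Rightarrow> 'a set set" where
  "pairs V = {e. e \<subseteq> V \<and> card e = 2}"

definition is_rb_graph :: "'a rb_graph \<Rightarrow> bool" where
  "is_rb_graph H \<longleftrightarrow> finite (verts H) \<and> red H \<subseteq> pairs (verts H) \<and>
     blue H \<subseteq> pairs (verts H) \<and> red H \<inter> blue H = {}"

definition is_rb_clique :: "'a rb_graph \<Rightarrow> bool" where
  "is_rb_clique G \<longleftrightarrow> is_rb_graph G \<and> red G \<union> blue G = pairs (verts G)"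

text \<open>The extensional function space makes each map on the vertices of \<open>H\<close> count once.\<close>

definition hom_count :: "'a rb_graph \<Rightarrow> 'b rb_graph \<Rightarrow> nat" where
  "hom_count H G = card {f \<in> verts H \<rightarrow>\<^sub>E verts G. inj_on f (verts H) \<and>
     (\<forall>e\<in>red H. f ` e \<in> red G) \<and> (\<forall>e\<in>blue H. f ` e \<in> blue G)}"

text \<open>
  Every finite clique is isomorphic to one with vertices in \<open>nat\<close>, so host cliques are taken
  over \<open>nat\<close>. There are infinitely many of them on \<open>n\<close> vertices, but only finitely many values
  of \<open>hom_count\<close>, since these are at most \<open>n ^ card (verts H)\<close> for finite \<open>H\<close>.
\<close>

definition max_count :: "'a rb_graph \<Rightarrow> nat \<Rightarrow> nat" where
  "max_count H n =
     Max {hom_count H G |G :: nat rb_graph. is_rb_clique G \<and> card (verts G) = n}"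

definition normalized_max :: "'a rb_graph \<Rightarrow> nat \<Rightarrow> real" where
  "normalized_max H n = real (max_count H n) / real n ^ card (verts H)"

definition max_density :: "'a rb_graph \<Rightarrow> real" where
  "max_density H = lim (normalized_max H)"

text \<open>Sequences are indexed from 1; the entry at index 0 is unconstrained.\<close>

definition has_density :: "(nat \<Rightarrow> nat rb_graph) \<Rightarrow> real \<Rightarrow> bool" where
  "has_density G \<beta> \<longleftrightarrow>
     (\<forall>n\<ge>1. is_rb_clique (G n) \<and> card (verts (G n)) = n) \<and>
     (\<lambda>n. real (card (red (G n))) / real (card (pairs (verts (G n))))) \<longlonglongrightarrow> \<beta>"

definition normalized_count :: "'a rb_graph \<Rightarrow> (nat \<Rightarrow> nat rb_graph) \<Rightarrow> nat \<Rightarrow> real" where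
  "normalized_count H G n = real (hom_count H (G n)) / real n ^ card (verts H)"

definition good :: "'a rb_graph \<Rightarrow> (nat \<Rightarrow> nat rb_graph) \<Rightarrow> bool" where
  "good H G \<longleftrightarrow> convergent (normalized_count H G)"

definition rho :: "'a rb_graph \<Rightarrow> (nat \<Rightarrow> nat rb_graph) \<Rightarrow> real" where
  "rho H G = lim (normalized_count H G)"

definition I_sup :: "'a rb_graph \<Rightarrow> real \<Rightarrow> real" where
  "I_sup H \<beta> = Sup {rho H G |G. has_density G \<beta> \<and> good H G}"

definition red_degree :: "'a rb_graph \<Rightarrow> 'a \<Rightarrow> nat" where
  "red_degree G x = card {y \<in> verts G. {x, y} \<in> red G}"

definition asymptotically_regular :: "(nat \<Rightarrow> nat rb_graph) \<Rightarrow> real \<Rightarrow> bool" where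
  "asymptotically_regular G \<beta> \<longleftrightarrow> has_density G \<beta> \<and>
     (\<forall>\<epsilon>>0. \<forall>\<^sub>F n in sequentially.
        real (card {x \<in> verts (G n).
          real (red_degree (G n) x) \<notin> {(\<beta> - \<epsilon>) * real n..(\<beta> + \<epsilon>) * real n}}) \<le> \<epsilon> * real n)"

datatype double_star_vertex = Center_v | Center_u | Leaf_v nat | Leaf_u nat

definition D :: "nat \<Rightarrow> double_star_vertex rb_graph" where
  "D s = \<lparr>verts = {Center_v, Center_u} \<union> Leaf_v ` {1..s} \<union> Leaf_u ` {1..s},
          red = (\<lambda>i. {Leaf_v i, Center_v}) ` {1..s} \<union> (\<lambda>i. {Center_u, Leaf_u i}) ` {1..s},
          blue = {{Center_u, Center_v}}\<rparr>"

lemma is_rb_graph_D: "is_rb_graph (D s)"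
  by (auto simp: is_rb_graph_def D_def pairs_def doubleton_eq_iff)

lemma card_verts_D: "card (verts (D s)) = 2 * s + 2"
proof -
  have "card (Leaf_v ` {1..s} \<union> Leaf_u ` {1..s}) = s + s"
    by (subst card_Un_disjoint) (auto simp: card_image inj_on_def)
  moreover have "verts (D s) =
      insert Center_v (insert Center_u (Leaf_v ` {1..s} \<union> Leaf_u ` {1..s}))"
    by (auto simp: D_def)
  moreover have "Center_v \<notin> insert Center_u (Leaf_v ` {1..s} \<union> Leaf_u ` {1..s})"
    and "Center_u \<notin> Leaf_v ` {1..s} \<union> Leaf_u ` {1..s}"
    by auto
  ultimately show ?thesis
    by (simp del: insert_iff Un_iff)
qed

end

theory Submission
  imports Defs
begin

text \<open>
  A copy of \<open>D s\<close> consists of an ordered pair of centres \<open>(v, u)\<close> joined by a blue edge, \<open>s\<close> red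
  neighbours of \<open>v\<close> and \<open>s\<close> red neighbours of \<open>u\<close>. If coincidences between the leaves are allowed,
  the number of copies is exactly the sum of \<open>d(v)\<^sup>s d(u)\<^sup>s\<close> over all blue arcs, where \<open>d\<close> is the red
  degree (\<open>card_colour_maps_D\<close>). Maps with a coincidence number \<open>O(n\<^bsup>2s+1\<^esup>)\<close>, which is of lower
  order (\<open>colour_maps_le_hom_count\<close>).

  Upper bound: by the inequality between arithmetic and geometric means, \<open>d(v)\<^sup>s d(u)\<^sup>s\<close> is at most
  the mean of \<open>d(v)\<^bsup>2s\<^esup>\<close> and \<open>d(u)\<^bsup>2s\<^esup>\<close>, and a vertex \<open>v\<close> lies in fewer than \<open>n - d(v)\<close> blue edges.
  So the normalised count is at most the average of \<open>f(d(v)/n)\<close> over the vertices, for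
  \<open>f(x) = x\<^bsup>2s\<^esup>(1 - x)\<close>. This \<open>f\<close> is not concave on the unit interval, but its tangent line at
  \<open>\<beta>\<close> lies above it on all of \<open>x \<ge> 0\<close> as soon as \<open>\<beta> \<ge> 1 - 1/(2s)\<close>, which is exactly the condition
  that the tangent line is nonnegative at \<open>0\<close> (\<open>tangent_line_above\<close>). Averaging the tangent line
  only needs the average red degree, and this is asymptotically \<open>\<beta>n\<close>; the bound is \<open>f(\<beta>)\<close>.

  Lower bound: if almost all red degrees are at least \<open>(\<beta> - \<epsilon>)n\<close>, then almost all of the roughly
  \<open>(1 - \<beta>)n\<^sup>2\<close> blue arcs contribute at least \<open>((\<beta> - \<epsilon>)n)\<^bsup>2s\<^esup>\<close>. Hence asymptotically regular
  sequences attain \<open>f(\<beta>)\<close>, and they exist: colour \<open>{i, j}\<close> red when \<open>(i + j) mod n < \<beta>n\<close>.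

  The maximum over all densities is governed by \<open>\<beta> = 2s/(2s + 1)\<close>, the maximum point of \<open>f\<close>. There
  the tangent line is horizontal, so the upper bound holds for each clique whatever its density,
  and the same regular sequence supplies the lower bound.
\<close>

section \<open>The tangent line inequality\<close>

text \<open>
  The error of the first order expansion of \<open>x\<^bsup>m+1\<^esup>\<close> at \<open>b\<close>. For \<open>f(x) = x\<^bsup>m+1\<^esup> - x\<^bsup>m+2\<^esup>\<close>, the tangent
  line of \<open>f\<close> at \<open>b\<close> exceeds \<open>f\<close> by the remainder for \<open>m + 1\<close> minus the remainder for \<open>m\<close>.
\<close>

definition taylor_remainder :: "nat \<Rightarrow> real \<Rightarrow> real \<Rightarrow> real" where
  "taylor_remainder m b x = x ^ Suc m - b ^ Suc m - real (Suc m) * b ^ m * (x - b)"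

lemma taylor_remainder_Suc:
  "taylor_remainder (Suc m) b x = x * taylor_remainder m b x + real (Suc m) * b ^ m * (x - b)\<^sup>2"
  by (simp add: taylor_remainder_def algebra_simps power2_eq_square)

text \<open>
  The recursion above turns the difference of consecutive remainders, at \<open>m + 1\<close>, into \<open>x\<close> times the
  difference at \<open>m\<close> plus \<open>(x - b)\<^sup>2 b\<^sup>m ((m + 2) b - (m + 1))\<close>. Nonnegativity of the last factor is the
  hypothesis at \<open>m + 1\<close>, and it implies the one at \<open>m\<close> because \<open>m/(m + 1)\<close> increases with \<open>m\<close>.
\<close>

lemma taylor_remainder_le_Suc:
  assumes "0 \<le> x" "real m \<le> real (Suc m) * b"
  shows "taylor_remainder m b x \<le> taylor_remainder (Suc m) b x"
  using assms(2)
proof (induction m)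
  case 0
  show ?case by (simp add: taylor_remainder_Suc) (simp add: taylor_remainder_def)
next
  case (Suc m)
  have b: "0 \<le> b"
    using Suc.prems by (metis of_nat_0_le_iff of_nat_0_less_iff order_trans zero_le_mult_iff
        not_less zero_less_Suc)
  have "(real m + 1) \<le> (real m + 2) * b" using Suc.prems by (simp add: algebra_simps)
  then have "(real m + 1) / (real m + 2) \<le> b" by (simp add: field_simps)
  moreover have "real m / (real m + 1) \<le> (real m + 1) / (real m + 2)"
    by (simp add: field_simps)
  ultimately have "real m / (real m + 1) \<le> b" by linarith
  then have "real m \<le> real (Suc m) * b" by (simp add: field_simps)
  then have IH: "taylor_remainder m b x \<le> taylor_remainder (Suc m) b x" by (rule Suc.IH)
  have "taylor_remainder (Suc (Suc m)) b x - taylor_remainder (Suc m) b x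
      = x * (taylor_remainder (Suc m) b x - taylor_remainder m b x)
        + (x - b)\<^sup>2 * b ^ m * (real (Suc (Suc m)) * b - real (Suc m))"
    by (subst (1 2) taylor_remainder_Suc) (simp add: algebra_simps)
  also have "\<dots> \<ge> 0"
    using assms(1) IH Suc.prems b by (intro add_nonneg_nonneg mult_nonneg_nonneg) auto
  finally show ?case by simp
qed

text \<open>
  The derivative of \<open>x\<^sup>k (1 - x)\<close> at \<open>b\<close>.
\<close>

definition tangent_slope :: "nat \<Rightarrow> real \<Rightarrow> real" where
  "tangent_slope k b = real k * b ^ (k - 1) - real (Suc k) * b ^ k"

lemma tangent_line_above:
  assumes "0 \<le> x" "k \<ge> 1" "1 - 1 / real k \<le> b"
  shows "x ^ k * (1 - x) \<le> b ^ k * (1 - b) + tangent_slope k b * (x - b)"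
proof -
  obtain m where k: "k = Suc m" using assms(2) by (cases k) auto
  have "real m \<le> real (Suc m) * b" using assms(3) by (simp add: k field_simps)
  from taylor_remainder_le_Suc[OF assms(1) this] show ?thesis
    by (simp add: k taylor_remainder_def tangent_slope_def algebra_simps)
qed

section \<open>Degrees in cliques\<close>

definition neighbours :: "'a set set \<Rightarrow> 'a \<Rightarrow> 'a set" where
  "neighbours E x = {y. {x, y} \<in> E}"

lemma neighbours_subset: "E \<subseteq> pairs V \<Longrightarrow> neighbours E x \<subseteq> V - {x}"
  by (fastforce simp: neighbours_def pairs_def)

lemma red_degree_eq: "is_rb_graph G \<Longrightarrow> red_degree G x = card (neighbours (red G) x)"
  unfolding red_degree_def is_rb_graph_def
  by (rule arg_cong[where f = card]) (use neighbours_subset[of "red G" "verts G" x] in \<open>auto simp: neighbours_def\<close>)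

lemma card_pairs: "finite V \<Longrightarrow> card (pairs V) = card V choose 2"
  by (simp add: pairs_def n_subsets)

lemma choose_two_real: "real (n choose 2) = real n * (real n - 1) / 2"
proof (induction n)
  case (Suc n)
  then show ?case by (simp add: numeral_2_eq_2 field_simps)
qed simp

lemma handshake:
  assumes "finite V" "E \<subseteq> pairs V"
  shows "(\<Sum>x\<in>V. card (neighbours E x)) = 2 * card E"
proof -
  have finE: "finite E" using assms by (auto simp: pairs_def intro: finite_subset[of E "Pow V"])
  have "card (neighbours E x) = card {e \<in> E. x \<in> e}" for x
  proof (rule bij_betw_same_card)
    show "bij_betw (\<lambda>y. {x, y}) (neighbours E x) {e \<in> E. x \<in> e}"
      unfolding bij_betw_def
    proof
      show "inj_on (\<lambda>y. {x, y}) (neighbours E x)" by (auto simp: inj_on_def doubleton_eq_iff)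
      have "\<exists>y. e = {x, y} \<and> y \<in> neighbours E x" if "e \<in> E" "x \<in> e" for e
      proof -
        have "card e = 2" using that assms(2) by (auto simp: pairs_def)
        then obtain a b where "e = {a, b}" by (auto simp: card_2_iff)
        with that(2) obtain y where "e = {x, y}" by (auto simp: insert_commute)
        then show ?thesis using that by (auto simp: neighbours_def)
      qed
      then show "(\<lambda>y. {x, y}) ` neighbours E x = {e \<in> E. x \<in> e}"
        by (auto simp: neighbours_def image_iff)
    qed
  qed
  then have "(\<Sum>x\<in>V. card (neighbours E x)) = (\<Sum>x\<in>V. card {e \<in> E. x \<in> e})" by simp
  also have "\<dots> = 2 * card E"
  proof (rule sum_multicount[OF assms(1) finE], rule ballI)
    fix e assume "e \<in> E"
    then have "e \<subseteq> V" "card e = 2" using assms(2) by (auto simp: pairs_def)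
    moreover have "{x \<in> V. x \<in> e} = e" using \<open>e \<subseteq> V\<close> by blast
    ultimately show "card {x \<in> V. x \<in> e} = 2" by simp
  qed
  finally show ?thesis .
qed

lemma red_blue_degree:
  assumes "is_rb_clique G" "x \<in> verts G"
  shows "red_degree G x + card (neighbours (blue G) x) + 1 = card (verts G)"
proof -
  have g: "is_rb_graph G" and fin: "finite (verts G)"
    and r: "red G \<subseteq> pairs (verts G)" and b: "blue G \<subseteq> pairs (verts G)"
    and disj: "red G \<inter> blue G = {}" and un: "red G \<union> blue G = pairs (verts G)"
    using assms(1) by (auto simp: is_rb_clique_def is_rb_graph_def)
  have eq: "verts G - {x} = neighbours (red G) x \<union> neighbours (blue G) x"
  proof
    show "neighbours (red G) x \<union> neighbours (blue G) x \<subseteq> verts G - {x}"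
      using neighbours_subset[OF r] neighbours_subset[OF b] by blast
    have "{x, y} \<in> red G \<union> blue G" if "y \<in> verts G - {x}" for y
      using that assms(2) unfolding un pairs_def by auto
    then show "verts G - {x} \<subseteq> neighbours (red G) x \<union> neighbours (blue G) x"
      by (auto simp: neighbours_def)
  qed
  have "finite (neighbours (red G) x)" "finite (neighbours (blue G) x)"
    using fin eq by (metis finite_Diff finite_Un)+
  then have "card (verts G - {x}) = red_degree G x + card (neighbours (blue G) x)"
    unfolding eq red_degree_eq[OF g]
    by (intro card_Un_disjoint) (use disj in \<open>auto simp: neighbours_def\<close>)
  then show ?thesis using assms(2) fin by (simp add: card_Diff_singleton)
       (metis assms(2) card_gt_0_iff empty_iff Suc_pred)
qed

section \<open>Counting copies of the double star\<close>

text \<open>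
  Colour-preserving maps without the injectivity requirement: the choices of the leaves are then
  independent of each other, so these maps can be counted exactly.
\<close>

definition colour_maps :: "'a rb_graph \<Rightarrow> 'b rb_graph \<Rightarrow> ('a \<Rightarrow> 'b) set" where
  "colour_maps H G = {f \<in> verts H \<rightarrow>\<^sub>E verts G.
     (\<forall>e\<in>red H. f ` e \<in> red G) \<and> (\<forall>e\<in>blue H. f ` e \<in> blue G)}"

lemma hom_count_eq: "hom_count H G = card {f \<in> colour_maps H G. inj_on f (verts H)}"
  unfolding hom_count_def colour_maps_def by (rule arg_cong[where f = card]) auto

lemma finite_colour_maps: "finite (verts H) \<Longrightarrow> finite (verts G) \<Longrightarrow> finite (colour_maps H G)"
  by (rule finite_subset[of _ "verts H \<rightarrow>\<^sub>E verts G"])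
    (auto simp: colour_maps_def finite_PiE)

lemma hom_count_le_colour_maps:
  "finite (verts H) \<Longrightarrow> finite (verts G) \<Longrightarrow> hom_count H G \<le> card (colour_maps H G)"
  unfolding hom_count_eq by (intro card_mono finite_colour_maps) auto

text \<open>
  A non-injective map identifies some pair \<open>a \<noteq> b\<close> and is determined by its values off \<open>a\<close>; the bound
  is the union bound over the ordered pairs.
\<close>

lemma card_non_injective_le:
  assumes "finite A" "finite B"
  shows "card {f \<in> A \<rightarrow>\<^sub>E B. \<not> inj_on f A} \<le> (card A)\<^sup>2 * card B ^ (card A - 1)"
proof -
  let ?C = "\<lambda>p. {f \<in> A \<rightarrow>\<^sub>E B. f (fst p) = f (snd p)}"
  let ?P = "{p \<in> A \<times> A. fst p \<noteq> snd p}"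
  have fin: "finite (A \<rightarrow>\<^sub>E B)" using assms by (simp add: finite_PiE)
  have "card (?C p) \<le> card B ^ (card A - 1)" if p: "p \<in> ?P" for p
  proof -
    obtain a b where ab: "p = (a, b)" "a \<in> A" "b \<in> A" "a \<noteq> b" using p by auto
    have "card (?C p) \<le> card ((A - {a}) \<rightarrow>\<^sub>E B)"
    proof (rule card_inj_on_le)
      show "inj_on (\<lambda>f. restrict f (A - {a})) (?C p)"
      proof (rule inj_onI)
        fix f g assume fg: "f \<in> ?C p" "g \<in> ?C p"
          and eq: "restrict f (A - {a}) = restrict g (A - {a})"
        have *: "f x = g x" if "x \<in> A - {a}" for x
          using fun_cong[OF eq, of x] that by simp
        have "f a = g a" using fg *[of b] ab by auto
        with * fg show "f = g" by (intro PiE_ext[of f A "\<lambda>_. B" g]) auto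
      qed
      show "(\<lambda>f. restrict f (A - {a})) ` ?C p \<subseteq> (A - {a}) \<rightarrow>\<^sub>E B"
        by (intro image_subsetI restrict_PiE_iff[THEN iffD2] ballI) (auto simp: PiE_iff)
      show "finite ((A - {a}) \<rightarrow>\<^sub>E B)" using assms by (simp add: finite_PiE)
    qed
    also have "\<dots> = card B ^ (card A - 1)" using assms ab by (simp add: card_PiE)
    finally show ?thesis .
  qed
  then have "(\<Sum>p\<in>?P. card (?C p)) \<le> (\<Sum>p\<in>?P. card B ^ (card A - 1))" by (rule sum_mono)
  also have "\<dots> = card ?P * card B ^ (card A - 1)" by simp
  also have "card ?P \<le> card (A \<times> A)" using assms by (intro card_mono) auto
  finally have le: "(\<Sum>p\<in>?P. card (?C p)) \<le> (card A)\<^sup>2 * card B ^ (card A - 1)"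
    by (simp add: card_cartesian_product power2_eq_square)
  have "{f \<in> A \<rightarrow>\<^sub>E B. \<not> inj_on f A} \<subseteq> (\<Union>p\<in>?P. ?C p)" by (fastforce simp: inj_on_def)
  then have "card {f \<in> A \<rightarrow>\<^sub>E B. \<not> inj_on f A} \<le> card (\<Union>p\<in>?P. ?C p)"
    using assms fin by (intro card_mono) auto
  also have "\<dots> \<le> (\<Sum>p\<in>?P. card (?C p))" using assms by (intro card_UN_le) auto
  finally show ?thesis using le by linarith
qed

lemma colour_maps_le_hom_count:
  assumes "finite (verts H)" "finite (verts G)"
  shows "card (colour_maps H G) \<le> hom_count H G
     + (card (verts H))\<^sup>2 * card (verts G) ^ (card (verts H) - 1)"
proof -
  let ?N = "{f \<in> verts H \<rightarrow>\<^sub>E verts G. \<not> inj_on f (verts H)}"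
  have "colour_maps H G \<subseteq> {f \<in> colour_maps H G. inj_on f (verts H)} \<union> ?N"
    by (auto simp: colour_maps_def)
  then have "card (colour_maps H G) \<le> card ({f \<in> colour_maps H G. inj_on f (verts H)} \<union> ?N)"
    using finite_colour_maps[OF assms] assms by (intro card_mono) (auto simp: finite_PiE)
  also have "\<dots> \<le> hom_count H G + card ?N" unfolding hom_count_eq by (rule card_Un_le)
  finally show ?thesis using card_non_injective_le[OF assms] by linarith
qed

lemma finite_verts_D: "finite (verts (D s))"
  using is_rb_graph_D by (auto simp: is_rb_graph_def)

lemma colour_maps_D_iff:
  "f \<in> colour_maps (D s) G \<longleftrightarrow> f \<in> verts (D s) \<rightarrow>\<^sub>E verts G \<and>
     (\<forall>i\<in>{1..s}. {f Center_v, f (Leaf_v i)} \<in> red G \<and> {f Center_u, f (Leaf_u i)} \<in> red G) \<and>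
     {f Center_v, f Center_u} \<in> blue G"
proof -
  have "(\<forall>e\<in>red (D s). f ` e \<in> red G) \<longleftrightarrow>
      (\<forall>i\<in>{1..s}. {f Center_v, f (Leaf_v i)} \<in> red G \<and> {f Center_u, f (Leaf_u i)} \<in> red G)"
    unfolding D_def rb_graph.simps ball_Un ball_simps image_insert image_empty
    by (simp add: insert_commute ball_conj_distrib)
  moreover have "(\<forall>e\<in>blue (D s). f ` e \<in> blue G) \<longleftrightarrow> {f Center_v, f Center_u} \<in> blue G"
    by (simp add: D_def insert_commute)
  ultimately show ?thesis by (simp add: colour_maps_def)
qed

text \<open>
  A colour-preserving map is the same as the images \<open>v\<close>, \<open>u\<close> of the two centres together with one
  function listing red neighbours of \<open>v\<close> and another listing red neighbours of \<open>u\<close>.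
\<close>

lemma card_colour_maps_D:
  assumes G: "is_rb_graph G"
  shows "card (colour_maps (D s) G)
    = (\<Sum>v\<in>verts G. \<Sum>u\<in>neighbours (blue G) v. red_degree G v ^ s * red_degree G u ^ s)"
proof -
  have fin: "finite (verts G)" and r: "red G \<subseteq> pairs (verts G)" and b: "blue G \<subseteq> pairs (verts G)"
    using G by (auto simp: is_rb_graph_def)
  have finb: "finite (neighbours (blue G) v)" and finr: "finite (neighbours (red G) v)" for v
    using neighbours_subset[OF r, of v] neighbours_subset[OF b, of v] fin
    by (auto intro: finite_subset)
  have inr: "y \<in> verts G" if "y \<in> neighbours (red G) x" for x y
    using neighbours_subset[OF r, of x] that by auto
  have inb: "y \<in> verts G" if "y \<in> neighbours (blue G) x" for x y
    using neighbours_subset[OF b, of x] that by auto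
  let ?P = "\<lambda>v. {1..s} \<rightarrow>\<^sub>E neighbours (red G) v"
  let ?S = "SIGMA v:verts G. SIGMA u:neighbours (blue G) v. ?P v \<times> ?P u"
  let ?F = "\<lambda>f. (f Center_v, f Center_u, restrict (\<lambda>i. f (Leaf_v i)) {1..s},
                 restrict (\<lambda>i. f (Leaf_u i)) {1..s})"
  let ?B = "\<lambda>(v, u, p, q). restrict (\<lambda>x. case x of Center_v \<Rightarrow> v | Center_u \<Rightarrow> u
                 | Leaf_v i \<Rightarrow> p i | Leaf_u i \<Rightarrow> q i) (verts (D s))"
  have "bij_betw ?F (colour_maps (D s) G) ?S"
  proof (rule bij_betw_byWitness[where f' = ?B])
    show "\<forall>f\<in>colour_maps (D s) G. ?B (?F f) = f"
    proof
      fix f assume "f \<in> colour_maps (D s) G"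
      then have ext: "f x = undefined" if "x \<notin> verts (D s)" for x
        using that by (auto simp: colour_maps_def PiE_iff extensional_def)
      show "?B (?F f) = f"
      proof
        fix x show "?B (?F f) x = f x"
          using ext[of x] by (cases x) (auto simp: D_def)
      qed
    qed
    show "\<forall>t\<in>?S. ?F (?B t) = t"
      by (auto simp: D_def fun_eq_iff PiE_iff extensional_def)
    show "?F ` colour_maps (D s) G \<subseteq> ?S"
    proof (rule image_subsetI)
      fix f assume f: "f \<in> colour_maps (D s) G"
      then have "f Center_v \<in> verts G" by (auto simp: colour_maps_def D_def)
      with f show "?F f \<in> ?S"
        by (simp add: colour_maps_D_iff neighbours_def insert_commute)
    qed
    show "?B ` ?S \<subseteq> colour_maps (D s) G"
    proof
      fix f assume "f \<in> ?B ` ?S"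
      then obtain v u p q where f: "f = ?B (v, u, p, q)" and v: "v \<in> verts G"
        and u: "u \<in> neighbours (blue G) v" and p: "p \<in> ?P v" and q: "q \<in> ?P u" by auto
      have "p i \<in> verts G" "q i \<in> verts G" if "i \<in> {1..s}" for i
        using p q that by (meson PiE_mem inr)+
      then have "f \<in> verts (D s) \<rightarrow>\<^sub>E verts G"
        unfolding f using v u[THEN inb] by (auto simp: D_def PiE_iff)
      moreover have "f Center_v = v" "f Center_u = u"
        "\<And>i. i \<in> {1..s} \<Longrightarrow> f (Leaf_v i) = p i" "\<And>i. i \<in> {1..s} \<Longrightarrow> f (Leaf_u i) = q i"
        by (auto simp: f D_def)
      ultimately show "f \<in> colour_maps (D s) G"
        using u p q
        by (simp add: colour_maps_D_iff neighbours_def PiE_iff insert_commute)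
    qed
  qed
  then have "card (colour_maps (D s) G) = card ?S" by (rule bij_betw_same_card)
  also have "\<dots> = (\<Sum>v\<in>verts G. \<Sum>u\<in>neighbours (blue G) v. card (?P v) * card (?P u))"
    using fin finb finr by (simp add: card_SigmaI card_cartesian_product finite_PiE finite_SigmaI)
  also have "\<dots> = (\<Sum>v\<in>verts G. \<Sum>u\<in>neighbours (blue G) v. red_degree G v ^ s * red_degree G u ^ s)"
    by (simp add: card_PiE red_degree_eq[OF G])
  finally show ?thesis .
qed

section \<open>Bounds for a single clique\<close>

text \<open>
  Each edge gives two opposite arcs, so a weight at the heads of the arcs may be moved to the tails.
\<close>

lemma sum_arcs_commute:
  assumes "finite V" "E \<subseteq> pairs V"
  shows "(\<Sum>v\<in>V. \<Sum>u\<in>neighbours E v. g u) = (\<Sum>v\<in>V. real (card (neighbours E v)) * g v)"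
proof -
  have eq: "neighbours E v = {u \<in> V. {v, u} \<in> E}" for v
    using neighbours_subset[OF assms(2), of v] by (auto simp: neighbours_def)
  have "(\<Sum>v\<in>V. \<Sum>u\<in>neighbours E v. g u) = (\<Sum>u\<in>V. \<Sum>v\<in>{v \<in> V. {v, u} \<in> E}. g u)"
    unfolding eq using assms(1) by (intro sum.swap_restrict)
  also have "\<dots> = (\<Sum>u\<in>V. real (card (neighbours E u)) * g u)"
    by (simp add: eq insert_commute)
  finally show ?thesis .
qed

text \<open>
  Applying AM-GM to the two ends of each blue arc decouples them. After this step only the red
  degrees matter, and no longer how they are arranged.
\<close>

lemma colour_maps_D_le_degree_sum:
  assumes G: "is_rb_clique G" and n: "card (verts G) = n"
  shows "real (card (colour_maps (D s) G))
     \<le> (\<Sum>v\<in>verts G. real (red_degree G v) ^ (2 * s) * (real n - real (red_degree G v)))"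
proof -
  let ?d = "\<lambda>v. real (red_degree G v)" and ?N = "neighbours (blue G)" and ?V = "verts G"
  have g: "is_rb_graph G" and fin: "finite ?V" and b: "blue G \<subseteq> pairs ?V"
    using G by (auto simp: is_rb_clique_def is_rb_graph_def)
  have amgm: "?d v ^ s * ?d u ^ s \<le> ?d v ^ (2 * s) / 2 + ?d u ^ (2 * s) / 2" for v u
    using sum_squares_bound[of "?d v ^ s" "?d u ^ s"] by (simp add: power_mult mult.commute[of 2 s])
  have "real (card (colour_maps (D s) G)) = (\<Sum>v\<in>?V. \<Sum>u\<in>?N v. ?d v ^ s * ?d u ^ s)"
    by (simp add: card_colour_maps_D[OF g])
  also have "\<dots> \<le> (\<Sum>v\<in>?V. \<Sum>u\<in>?N v. ?d v ^ (2 * s) / 2 + ?d u ^ (2 * s) / 2)"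
    by (intro sum_mono amgm)
  also have "\<dots> = (\<Sum>v\<in>?V. real (card (?N v)) * (?d v ^ (2 * s) / 2))
      + (\<Sum>v\<in>?V. \<Sum>u\<in>?N v. ?d u ^ (2 * s) / 2)"
    by (simp add: sum.distrib)
  also have "(\<Sum>v\<in>?V. \<Sum>u\<in>?N v. ?d u ^ (2 * s) / 2)
      = (\<Sum>v\<in>?V. real (card (?N v)) * (?d v ^ (2 * s) / 2))"
    by (rule sum_arcs_commute[OF fin b])
  also have "(\<Sum>v\<in>?V. real (card (?N v)) * (?d v ^ (2 * s) / 2)) + \<dots>
      = (\<Sum>v\<in>?V. ?d v ^ (2 * s) * real (card (?N v)))"
    by (simp add: sum.distrib[symmetric] mult.commute)
  also have "\<dots> \<le> (\<Sum>v\<in>?V. ?d v ^ (2 * s) * (real n - ?d v))"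
  proof (intro sum_mono mult_left_mono)
    fix v assume "v \<in> ?V"
    from red_blue_degree[OF G this] n show "real (card (?N v)) \<le> real n - ?d v" by linarith
  qed simp
  finally show ?thesis .
qed

text \<open>
  The tangent line at \<open>\<beta>\<close>, summed over the vertices. The clique may have any density: the deviation
  from \<open>\<beta>\<close> enters linearly, with the slope of the tangent line as coefficient.
\<close>

lemma hom_count_D_upper:
  assumes G: "is_rb_clique G" and n: "card (verts G) = n" "n \<ge> 1"
    and s: "s \<ge> 1" and \<beta>: "1 - 1 / (2 * real s) \<le> \<beta>"
  shows "real (hom_count (D s) G) / real n ^ (2 * s + 2)
    \<le> \<beta> ^ (2 * s) * (1 - \<beta>) + tangent_slope (2 * s) \<beta> * (2 * real (card (red G)) / (real n)\<^sup>2 - \<beta>)"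
proof -
  let ?d = "\<lambda>v. real (red_degree G v)" and ?V = "verts G"
  let ?L = "\<beta> ^ (2 * s) * (1 - \<beta>)" and ?t = "tangent_slope (2 * s) \<beta>"
  have g: "is_rb_graph G" and fin: "finite ?V" and r: "red G \<subseteq> pairs ?V"
    using G by (auto simp: is_rb_clique_def is_rb_graph_def)
  have n0: "real n > 0" using n by simp
  have "(\<Sum>v\<in>?V. ?d v) = real (\<Sum>v\<in>?V. card (neighbours (red G) v))"
    by (simp add: red_degree_eq[OF g])
  also have "\<dots> = 2 * real (card (red G))"
    by (subst handshake[OF fin r]) simp
  finally have deg: "(\<Sum>v\<in>?V. ?d v) = 2 * real (card (red G))" .
  have "real (hom_count (D s) G) \<le> real (card (colour_maps (D s) G))"
    using hom_count_le_colour_maps[OF finite_verts_D fin] by simp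
  also have "\<dots> \<le> (\<Sum>v\<in>?V. ?d v ^ (2 * s) * (real n - ?d v))"
    by (rule colour_maps_D_le_degree_sum[OF G n(1)])
  also have "\<dots> = real n ^ (2 * s + 1) * (\<Sum>v\<in>?V. (?d v / n) ^ (2 * s) * (1 - ?d v / n))"
    unfolding sum_distrib_left
    using n0 by (intro sum.cong refl) (simp add: power_divide field_simps)
  also have "\<dots> \<le> real n ^ (2 * s + 1) * (\<Sum>v\<in>?V. ?L + ?t * (?d v / n - \<beta>))"
    using n0 s \<beta> by (intro mult_left_mono sum_mono tangent_line_above) auto
  also have "(\<Sum>v\<in>?V. ?L + ?t * (?d v / n - \<beta>))
      = n * ?L + ?t * ((\<Sum>v\<in>?V. ?d v) / n - n * \<beta>)"
    by (simp add: sum.distrib sum_distrib_left[symmetric] sum_subtractf sum_divide_distrib n)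
  also have "\<dots> = n * (?L + ?t * (2 * real (card (red G)) / (real n)\<^sup>2 - \<beta>))"
    unfolding deg using n0 by (simp add: field_simps power2_eq_square)
  finally show ?thesis
    using n0 by (simp add: pos_divide_le_eq mult.assoc mult.commute mult.left_commute)
qed

text \<open>
  Only blue arcs whose two ends both have red degree at least \<open>\<delta>n\<close> are kept. There are
  \<open>n\<^sup>2 - n\<close> ordered pairs of distinct vertices, of which twice the number of red edges are red, and each low-degree vertex
  spoils at most \<open>2n\<close> arcs. The final error term accounts for the non-injective maps.
\<close>

lemma hom_count_D_lower:
  assumes G: "is_rb_clique G" and n: "card (verts G) = n" "n \<ge> 1" and \<delta>: "0 \<le> \<delta>"
  shows "\<delta> ^ (2 * s) * (1 - 1 / real n - 2 * real (card (red G)) / (real n)\<^sup>2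
        - 2 * (real (card {x \<in> verts G. real (red_degree G x) < \<delta> * real n}) / real n))
      - (2 * real s + 2)\<^sup>2 / real n
    \<le> real (hom_count (D s) G) / real n ^ (2 * s + 2)"
proof -
  let ?d = "\<lambda>v. real (red_degree G v)" and ?N = "neighbours (blue G)" and ?V = "verts G"
  let ?B = "{x \<in> ?V. ?d x < \<delta> * real n}"
  let ?A = "SIGMA v:?V. ?N v"
  let ?A' = "{a \<in> ?A. fst a \<notin> ?B \<and> snd a \<notin> ?B}"
  have g: "is_rb_graph G" and fin: "finite ?V" and r: "red G \<subseteq> pairs ?V" and b: "blue G \<subseteq> pairs ?V"
    using G by (auto simp: is_rb_clique_def is_rb_graph_def)
  have n0: "real n > 0" using n by simp
  have sub: "?N v \<subseteq> ?V" for v using neighbours_subset[OF b, of v] by auto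
  then have finN: "finite (?N v)" for v using fin by (auto intro: finite_subset)
  have finA: "finite ?A" using fin finN by auto
  have "(\<Sum>v\<in>?V. red_degree G v) = 2 * card (red G)"
    using handshake[OF fin r] by (simp add: red_degree_eq[OF g])
  moreover have "(\<Sum>v\<in>?V. red_degree G v) + (\<Sum>v\<in>?V. card (?N v)) + n = n * n"
  proof -
    have "(\<Sum>v\<in>?V. red_degree G v + card (?N v) + 1) = (\<Sum>v\<in>?V. n)"
      by (intro sum.cong refl) (simp only: red_blue_degree[OF G] n)
    then show ?thesis by (simp only: sum.distrib sum_constant n mult_1_right of_nat_id)
  qed
  ultimately have "2 * card (red G) + card ?A + n = n * n"
    using fin finN by (simp add: card_SigmaI)
  then have cA: "real (card ?A) = real n * real n - real n - 2 * real (card (red G))"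
    by (simp add: algebra_simps flip: of_nat_mult)
  have "?A \<subseteq> ?A' \<union> (?B \<times> ?V \<union> ?V \<times> ?B)" using sub by auto
  then have "card ?A \<le> card (?A' \<union> (?B \<times> ?V \<union> ?V \<times> ?B))"
    using fin finA by (intro card_mono) auto
  also have "\<dots> \<le> card ?A' + (card (?B \<times> ?V) + card (?V \<times> ?B))"
    by (meson add_left_mono card_Un_le order_trans)
  finally have "card ?A \<le> card ?A' + 2 * card ?B * n"
    by (simp add: card_cartesian_product n mult.commute mult_2_right)
  then have "real (card ?A) \<le> real (card ?A' + 2 * card ?B * n)" by (rule of_nat_mono)
  then have cA': "real n * real n - real n - 2 * real (card (red G)) - 2 * real (card ?B) * n
      \<le> real (card ?A')"
    unfolding cA by simp
  have "(\<delta> * n) ^ (2 * s) * (real n * real n - real n - 2 * real (card (red G)) - 2 * real (card ?B) * n)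
      \<le> (\<delta> * n) ^ (2 * s) * real (card ?A')"
    using \<delta> cA' by (intro mult_left_mono) auto
  also have "\<dots> = (\<Sum>a\<in>?A'. (\<delta> * n) ^ s * (\<delta> * n) ^ s)"
    by (simp add: mult_2_right mult.commute flip: power_add)
  also have "\<dots> \<le> (\<Sum>a\<in>?A'. ?d (fst a) ^ s * ?d (snd a) ^ s)"
  proof (intro sum_mono mult_mono power_mono)
    fix a assume a: "a \<in> ?A'"
    show "\<delta> * n \<le> ?d (fst a)" "\<delta> * n \<le> ?d (snd a)" using a by (auto simp: not_less dest: sub[THEN subsetD])
  qed (use \<delta> in auto)
  also have "\<dots> \<le> (\<Sum>a\<in>?A. ?d (fst a) ^ s * ?d (snd a) ^ s)"
    using finA by (intro sum_mono2) auto
  also have "\<dots> = real (card (colour_maps (D s) G))"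
    unfolding card_colour_maps_D[OF g] using fin finN
    by (subst sum.Sigma) (auto simp: case_prod_unfold)
  also have "\<dots> \<le> real (hom_count (D s) G + (2 * s + 2)\<^sup>2 * n ^ (2 * s + 1))"
    using colour_maps_le_hom_count[OF finite_verts_D fin, of s, unfolded n card_verts_D]
    by (intro of_nat_mono) simp
  also have "\<dots> = real (hom_count (D s) G) + (2 * real s + 2)\<^sup>2 * real n ^ (2 * s + 1)" by simp
  finally have main: "(\<delta> * n) ^ (2 * s) * (real n * real n - real n - 2 * real (card (red G))
        - 2 * real (card ?B) * n) - (2 * real s + 2)\<^sup>2 * real n ^ (2 * s + 1)
      \<le> real (hom_count (D s) G)" by linarith
  have e1: "real n * real n - real n - 2 * real (card (red G)) - 2 * real (card ?B) * n
     = (real n)\<^sup>2 * (1 - 1 / real n - 2 * real (card (red G)) / (real n)\<^sup>2 - 2 * (real (card ?B) / real n))"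
    using n0 by (simp add: field_simps power2_eq_square)
  have e2: "(\<delta> ^ (2 * s) * X - K / n) * real n ^ (2 * s + 2)
      = (\<delta> * n) ^ (2 * s) * ((real n)\<^sup>2 * X) - K * real n ^ (2 * s + 1)" for X K :: real
    using n0 by (simp add: power_mult_distrib field_simps power2_eq_square)
  have "(\<delta> ^ (2 * s) * (1 - 1 / real n - 2 * real (card (red G)) / (real n)\<^sup>2
        - 2 * (real (card ?B) / real n)) - (2 * real s + 2)\<^sup>2 / real n) * real n ^ (2 * s + 2)
    \<le> real (hom_count (D s) G)"
    using main unfolding e1 e2 .
  then show ?thesis using n0 by (simp add: pos_le_divide_eq)
qed

section \<open>Limits along sequences\<close>

text \<open>
  Ordered pairs with repetition are a more convenient normalisation of the density than edges of
  the complete graph; the two differ by a factor of \<open>1 - 1/n\<close>.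
\<close>

lemma two_red_over_square_tendsto:
  assumes "has_density G \<beta>"
  shows "(\<lambda>n. 2 * real (card (red (G n))) / (real n)\<^sup>2) \<longlonglongrightarrow> \<beta>"
proof -
  let ?q = "\<lambda>n. real (card (red (G n))) / real (card (pairs (verts (G n))))"
  have "(\<lambda>n. ?q n * (1 - 1 / real n)) \<longlonglongrightarrow> \<beta> * (1 - 0)"
    using assms unfolding has_density_def by (intro tendsto_intros lim_1_over_n) auto
  moreover have "\<forall>\<^sub>F n in sequentially. ?q n * (1 - 1 / real n)
      = 2 * real (card (red (G n))) / (real n)\<^sup>2"
    using eventually_ge_at_top[of 2]
  proof eventually_elim
    case (elim n)
    then have "is_rb_clique (G n)" and c: "card (verts (G n)) = n"
      using assms by (auto simp: has_density_def)
    then have *: "real (card (pairs (verts (G n)))) = real n * (real n - 1) / 2"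
      by (subst card_pairs) (auto simp: is_rb_clique_def is_rb_graph_def choose_two_real)
    show ?case
      unfolding * using elim by (simp add: field_simps power2_eq_square)
  qed
  ultimately show ?thesis by (simp add: filterlim_cong[OF refl refl] tendsto_cong)
qed

lemma normalized_count_D_upper:
  assumes "s \<ge> 1" "1 - 1 / (2 * real s) \<le> \<beta>" "has_density G \<beta>"
  obtains U where "U \<longlonglongrightarrow> \<beta> ^ (2 * s) * (1 - \<beta>)"
    "\<forall>\<^sub>F n in sequentially. normalized_count (D s) G n \<le> U n"
proof
  let ?U = "\<lambda>n. \<beta> ^ (2 * s) * (1 - \<beta>)
      + tangent_slope (2 * s) \<beta> * (2 * real (card (red (G n))) / (real n)\<^sup>2 - \<beta>)"
  have "?U \<longlonglongrightarrow> \<beta> ^ (2 * s) * (1 - \<beta>) + tangent_slope (2 * s) \<beta> * (\<beta> - \<beta>)"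
    by (intro tendsto_intros two_red_over_square_tendsto assms)
  then show "?U \<longlonglongrightarrow> \<beta> ^ (2 * s) * (1 - \<beta>)" by simp
  show "\<forall>\<^sub>F n in sequentially. normalized_count (D s) G n \<le> ?U n"
    using eventually_ge_at_top[of 1]
  proof eventually_elim
    case (elim n)
    with assms(3) show ?case unfolding normalized_count_def card_verts_D
      by (intro hom_count_D_upper assms) (auto simp: has_density_def)
  qed
qed

lemma rho_D_le:
  assumes "s \<ge> 1" "1 - 1 / (2 * real s) \<le> \<beta>" "has_density G \<beta>" "good (D s) G"
  shows "rho (D s) G \<le> \<beta> ^ (2 * s) * (1 - \<beta>)"
proof -
  obtain U where U: "U \<longlonglongrightarrow> \<beta> ^ (2 * s) * (1 - \<beta>)"
    "\<forall>\<^sub>F n in sequentially. normalized_count (D s) G n \<le> U n"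
    using normalized_count_D_upper[OF assms(1-3)] .
  have "normalized_count (D s) G \<longlonglongrightarrow> rho (D s) G"
    using assms(4) by (simp add: good_def rho_def convergent_LIMSEQ_iff)
  then show ?thesis using U by (intro tendsto_le[OF _ U(1)]) auto
qed

text \<open>
  The upper half is the tangent line bound, which converges with the density. For the lower half, any \<open>a\<close> below the limit stays below
  \<open>(\<beta> - \<epsilon>)\<^bsup>2s\<^esup> (1 - \<beta> - 2\<epsilon>)\<close> for small \<open>\<epsilon>\<close>, which is the limit of the lower bound for a single clique
  with \<open>\<delta> = \<beta> - \<epsilon>\<close> and at most \<open>\<epsilon>n\<close> exceptional vertices.
\<close>

lemma normalized_count_D_tendsto:
  assumes "s \<ge> 1" "1 - 1 / (2 * real s) \<le> \<beta>" "asymptotically_regular G \<beta>"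
  shows "normalized_count (D s) G \<longlonglongrightarrow> \<beta> ^ (2 * s) * (1 - \<beta>)"
proof (rule order_tendstoI)
  let ?L = "\<beta> ^ (2 * s) * (1 - \<beta>)"
  have dens: "has_density G \<beta>" using assms by (simp add: asymptotically_regular_def)
  fix a
  {
    assume "?L < a"
    obtain U where U: "U \<longlonglongrightarrow> ?L" "\<forall>\<^sub>F n in sequentially. normalized_count (D s) G n \<le> U n"
      using normalized_count_D_upper[OF assms(1,2) dens] .
    from order_tendstoD(2)[OF U(1) \<open>?L < a\<close>] U(2)
    show "\<forall>\<^sub>F n in sequentially. normalized_count (D s) G n < a"
      by eventually_elim linarith
  }
  {
    assume "a < ?L"
    have "1 / (2 * real s) \<le> 1 / 2" using assms(1) by (simp add: field_simps)
    then have \<beta>0: "0 < \<beta>" using assms(2) by linarith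
    let ?h = "\<lambda>\<epsilon>. (\<beta> - \<epsilon>) ^ (2 * s) * (1 - \<beta> - 2 * \<epsilon>)"
    have "(?h \<longlongrightarrow> (\<beta> - 0) ^ (2 * s) * (1 - \<beta> - 2 * 0)) (at_right 0)"
      by (intro tendsto_intros)
    then have "(?h \<longlongrightarrow> ?L) (at_right 0)" by simp
    then have "\<forall>\<^sub>F \<epsilon> in at_right 0. a < ?h \<epsilon>" using \<open>a < ?L\<close> by (rule order_tendstoD)
    moreover have "\<forall>\<^sub>F \<epsilon> in at_right 0. \<epsilon> \<in> {0<..<\<beta>}"
      using \<beta>0 by (rule eventually_at_right_real)
    ultimately have "\<forall>\<^sub>F \<epsilon> in at_right 0. a < ?h \<epsilon> \<and> \<epsilon> \<in> {0<..<\<beta>}" by eventually_elim simp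
    then obtain \<epsilon> where \<epsilon>: "a < ?h \<epsilon>" "0 < \<epsilon>" "\<epsilon> < \<beta>"
      using eventually_happens'[OF trivial_limit_at_right_real] by fastforce
    let ?l = "\<lambda>n. (\<beta> - \<epsilon>) ^ (2 * s) * (1 - 1 / real n - 2 * real (card (red (G n))) / (real n)\<^sup>2
        - 2 * \<epsilon>) - (2 * real s + 2)\<^sup>2 * (1 / real n)"
    have "?l \<longlonglongrightarrow> (\<beta> - \<epsilon>) ^ (2 * s) * (1 - 0 - \<beta> - 2 * \<epsilon>) - (2 * real s + 2)\<^sup>2 * 0"
      by (intro tendsto_intros lim_1_over_n two_red_over_square_tendsto dens)
    then have "?l \<longlonglongrightarrow> ?h \<epsilon>" by simp
    then have "\<forall>\<^sub>F n in sequentially. a < ?l n" using \<epsilon>(1) by (rule order_tendstoD)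
    moreover have "\<forall>\<^sub>F n in sequentially.
        real (card {x \<in> verts (G n).
          real (red_degree (G n) x) \<notin> {(\<beta> - \<epsilon>) * real n..(\<beta> + \<epsilon>) * real n}}) \<le> \<epsilon> * real n"
      using assms(3) \<epsilon>(2) by (simp add: asymptotically_regular_def)
    ultimately show "\<forall>\<^sub>F n in sequentially. a < normalized_count (D s) G n"
      using eventually_ge_at_top[of 1]
    proof eventually_elim
      case (elim n)
      have c: "is_rb_clique (G n)" "card (verts (G n)) = n"
        using dens elim(3) by (auto simp: has_density_def)
      let ?B = "{x \<in> verts (G n). real (red_degree (G n) x) < (\<beta> - \<epsilon>) * real n}"
      have "card ?B \<le> card {x \<in> verts (G n).
          real (red_degree (G n) x) \<notin> {(\<beta> - \<epsilon>) * real n..(\<beta> + \<epsilon>) * real n}}"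
        using c(1) by (intro card_mono) (auto simp: is_rb_clique_def is_rb_graph_def)
      then have "real (card ?B) \<le> \<epsilon> * real n" using elim(2) by linarith
      then have "real (card ?B) / real n \<le> \<epsilon>" using elim(3) by (simp add: field_simps)
      then have "?l n \<le> (\<beta> - \<epsilon>) ^ (2 * s) * (1 - 1 / real n - 2 * real (card (red (G n))) / (real n)\<^sup>2
          - 2 * (real (card ?B) / real n)) - (2 * real s + 2)\<^sup>2 / real n"
        using \<epsilon> by (simp add: mult_left_mono)
      also have "\<dots> \<le> real (hom_count (D s) (G n)) / real n ^ (2 * s + 2)"
        using c elim(3) \<epsilon> by (intro hom_count_D_lower) auto
      finally show ?case using elim(1) unfolding normalized_count_def card_verts_D by linarith
    qed
  }
qed

section \<open>Asymptotically regular sequences of every density\<close>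

text \<open>
  The Cayley sum graph of the integers modulo \<open>n\<close>: for an edge \<open>e = {i, j}\<close> the sum over \<open>e\<close> is \<open>i + j\<close>.
  Unlike a circulant graph with a symmetric connection set, it needs no parity considerations.
\<close>

definition sum_graph :: "real \<Rightarrow> nat \<Rightarrow> nat rb_graph" where
  "sum_graph \<beta> n = (let R = {e \<in> pairs {..<n}. real (\<Sum>e mod n) < \<beta> * real n}
     in \<lparr>verts = {..<n}, red = R, blue = pairs {..<n} - R\<rparr>)"

lemma sum_graph_clique: "is_rb_clique (sum_graph \<beta> n)" "verts (sum_graph \<beta> n) = {..<n}"
  by (auto simp: is_rb_clique_def is_rb_graph_def sum_graph_def Let_def)

text \<open>
  As \<open>y\<close> runs through the residues so does \<open>x + y\<close>, so exactly \<open>\<lceil>\<beta>n\<rceil>\<close> values of \<open>y\<close> satisfy the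
  defining inequality. One of them may be \<open>x\<close> itself, which is not a neighbour; the rounding and this
  loss have opposite signs, so together they cost at most \<open>1\<close>.
\<close>

lemma red_degree_sum_graph:
  assumes "x < n" "0 \<le> \<beta>" "\<beta> \<le> 1"
  shows "\<bar>real (red_degree (sum_graph \<beta> n) x) - \<beta> * real n\<bar> \<le> 1"
proof -
  let ?T = "{y. y < n \<and> real ((x + y) mod n) < \<beta> * real n}"
  have "{y \<in> verts (sum_graph \<beta> n). {x, y} \<in> red (sum_graph \<beta> n)} = ?T - {x}"
    using assms by (auto simp: sum_graph_def Let_def pairs_def card_insert_if)
  then have deg: "red_degree (sum_graph \<beta> n) x = card (?T - {x})"
    by (simp add: red_degree_def)
  have "inj_on (\<lambda>y. (x + y) mod n) {..<n}"
  proof (rule inj_onI)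
    fix y z assume yz: "y \<in> {..<n}" "z \<in> {..<n}" "(x + y) mod n = (x + z) mod n"
    have "(x + w) mod n = (if x + w < n then x + w else x + w - n)" if "w < n" for w
      using assms(1) that by (simp add: le_mod_geq)
    then show "y = z" using yz assms(1) by (simp split: if_splits)
  qed
  moreover have "(\<lambda>y. (x + y) mod n) ` {..<n} \<subseteq> {..<n}" using assms(1) by auto
  ultimately have bij: "bij_betw (\<lambda>y. (x + y) mod n) {..<n} {..<n}"
    by (simp add: bij_betw_def endo_inj_surj)
  let ?K = "{k. k < n \<and> real k < \<beta> * real n}"
  have "bij_betw (\<lambda>y. (x + y) mod n) {y \<in> {..<n}. real ((x + y) mod n) < \<beta> * real n}
      {k \<in> {..<n}. real k < \<beta> * real n}"
    by (rule bij_betw_Collect[OF bij]) simp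
  then have "bij_betw (\<lambda>y. (x + y) mod n) ?T ?K" by simp
  then have "card ?T = card ?K" by (rule bij_betw_same_card)
  also have "?K = {..<nat \<lceil>\<beta> * real n\<rceil>}"
  proof -
    have "\<beta> * real n \<le> real n" using assms by (simp add: mult_left_le_one_le)
    then show ?thesis by (auto simp: zless_nat_eq_int_zless less_ceiling_iff)
  qed
  finally have T: "card ?T = nat \<lceil>\<beta> * real n\<rceil>" by simp
  have "0 \<le> \<beta> * real n" using assms by simp
  then have "\<beta> * real n \<le> real (card ?T)" "real (card ?T) < \<beta> * real n + 1"
    unfolding T by linarith+
  moreover have "card ?T - 1 \<le> card (?T - {x})" "card (?T - {x}) \<le> card ?T"
    by (auto intro: diff_card_le_card_Diff card_mono simp: card_Diff_singleton_if)
  ultimately show ?thesis unfolding deg by linarith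
qed

text \<open>
  The degree bound settles regularity at once; by the handshake identity it also shows that twice
  the number of red edges is within \<open>n\<close> of \<open>\<beta>n\<^sup>2\<close>, which gives the density.
\<close>

lemma sum_graph_asymptotically_regular:
  assumes "0 \<le> \<beta>" "\<beta> \<le> 1"
  shows "asymptotically_regular (sum_graph \<beta>) \<beta>"
proof -
  let ?G = "sum_graph \<beta>"
  let ?r = "\<lambda>n. real (card (red (?G n)))"
  let ?q = "\<lambda>n. ?r n / real (card (pairs (verts (?G n))))"
  have "\<bar>?q n - \<beta>\<bar> \<le> 2 / (real n - 1)" if n: "n \<ge> 2" for n
  proof -
    have r: "red (?G n) \<subseteq> pairs {..<n}" and g: "is_rb_graph (?G n)"
      using sum_graph_clique[of \<beta> n] by (auto simp: is_rb_clique_def is_rb_graph_def)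
    have "(\<Sum>x<n. real (red_degree (?G n) x)) = real (\<Sum>x<n. card (neighbours (red (?G n)) x))"
      by (simp add: red_degree_eq[OF g])
    also have "\<dots> = 2 * ?r n" by (subst handshake[OF _ r]) auto
    finally have "2 * ?r n - real n * (\<beta> * real n) = (\<Sum>x<n. real (red_degree (?G n) x) - \<beta> * real n)"
      by (simp add: sum_subtractf)
    also have "\<bar>\<dots>\<bar> \<le> (\<Sum>x<n. \<bar>real (red_degree (?G n) x) - \<beta> * real n\<bar>)" by (rule sum_abs)
    also have "\<dots> \<le> (\<Sum>x<n. 1)" using assms by (intro sum_mono red_degree_sum_graph) auto
    finally have 1: "\<bar>2 * ?r n - real n * (\<beta> * real n)\<bar> \<le> real n" by simp
    have "real n * (real n - 1) * (?q n - \<beta>) = (2 * ?r n - real n * (\<beta> * real n)) + \<beta> * real n"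
      using n by (simp add: card_pairs sum_graph_clique choose_two_real field_simps)
    moreover have "\<beta> * real n \<le> real n" "0 \<le> \<beta> * real n"
      using assms by (simp_all add: mult_left_le_one_le)
    ultimately have "\<bar>real n * (real n - 1) * (?q n - \<beta>)\<bar> \<le> 2 * real n"
      using 1 by (simp only: abs_le_iff) linarith
    then have "real n * ((real n - 1) * \<bar>?q n - \<beta>\<bar>) \<le> real n * 2"
      using n by (simp add: abs_mult mult_ac)
    then have "(real n - 1) * \<bar>?q n - \<beta>\<bar> \<le> 2"
      using n by (subst (asm) mult_le_cancel_left_pos) auto
    then show ?thesis using n by (simp add: pos_le_divide_eq mult.commute)
  qed
  then have "norm (?q n - \<beta>) \<le> norm (2 / (real n - 1)) * 1" if "n \<ge> 2" for n
    using that by fastforce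
  then have "\<forall>\<^sub>F n in sequentially. norm (?q n - \<beta>) \<le> norm (2 / (real n - 1)) * 1"
    by (intro eventually_sequentiallyI)
  moreover have "(\<lambda>n. 2 / (real n - 1)) \<longlonglongrightarrow> 0"
  proof (rule LIMSEQ_imp_Suc)
    show "(\<lambda>n. 2 / (real (Suc n) - 1)) \<longlonglongrightarrow> 0"
      using tendsto_mult_right_zero[OF lim_1_over_n, of "2::real"] by simp
  qed
  ultimately have "(\<lambda>n. ?q n - \<beta>) \<longlonglongrightarrow> 0" by (rule tendsto_0_le[rotated])
  then have "has_density ?G \<beta>"
    unfolding has_density_def by (simp add: sum_graph_clique LIM_zero_iff)
  moreover have "\<forall>\<^sub>F n in sequentially.
        real (card {x \<in> verts (?G n).
          real (red_degree (?G n) x) \<notin> {(\<beta> - \<epsilon>) * real n..(\<beta> + \<epsilon>) * real n}}) \<le> \<epsilon> * real n"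
    if \<epsilon>: "\<epsilon> > 0" for \<epsilon>
    using eventually_ge_at_top[of "nat \<lceil>1 / \<epsilon>\<rceil>"]
  proof eventually_elim
    case (elim n)
    then have "1 / \<epsilon> \<le> real n" by linarith
    then have n: "1 \<le> \<epsilon> * real n" using \<epsilon> by (simp add: field_simps)
    have "real (red_degree (?G n) x) \<in> {(\<beta> - \<epsilon>) * real n..(\<beta> + \<epsilon>) * real n}" if "x < n" for x
      using red_degree_sum_graph[OF that assms] n by (simp add: algebra_simps abs_le_iff)
    then have empty: "{x \<in> verts (?G n).
          real (red_degree (?G n) x) \<notin> {(\<beta> - \<epsilon>) * real n..(\<beta> + \<epsilon>) * real n}} = {}"
      by (auto simp: sum_graph_clique)
    show ?case unfolding empty using n by simp
  qed
  ultimately show ?thesis by (simp add: asymptotically_regular_def)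
qed

section \<open>The supremum at fixed density and the maximum\<close>

lemma I_sup_D:
  assumes "s \<ge> 1" "1 - 1 / (2 * real s) \<le> \<beta>" "\<beta> \<le> 1"
  shows "I_sup (D s) \<beta> = \<beta> ^ (2 * s) * (1 - \<beta>)"
  unfolding I_sup_def
proof (rule cSup_eq_maximum)
  have "1 / (2 * real s) \<le> 1" using assms(1) by (simp add: field_simps)
  then have "asymptotically_regular (sum_graph \<beta>) \<beta>"
    using assms by (intro sum_graph_asymptotically_regular) linarith+
  moreover from normalized_count_D_tendsto[OF assms(1,2) this]
  have "good (D s) (sum_graph \<beta>)" "rho (D s) (sum_graph \<beta>) = \<beta> ^ (2 * s) * (1 - \<beta>)"
    by (auto simp: good_def rho_def convergent_def dest: limI)
  ultimately show "\<beta> ^ (2 * s) * (1 - \<beta>) \<in> {rho (D s) G |G. has_density G \<beta> \<and> good (D s) G}"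
    unfolding asymptotically_regular_def by force
qed (use rho_D_le[OF assms(1,2)] in auto)

lemma finite_hom_counts:
  assumes "finite (verts H)"
  shows "finite {hom_count H G |G :: nat rb_graph. is_rb_clique G \<and> card (verts G) = n}"
proof (rule finite_subset)
  show "{hom_count H G |G :: nat rb_graph. is_rb_clique G \<and> card (verts G) = n}
      \<subseteq> {..n ^ card (verts H)}"
  proof
    fix k assume "k \<in> {hom_count H G |G :: nat rb_graph. is_rb_clique G \<and> card (verts G) = n}"
    then obtain G :: "nat rb_graph" where G: "is_rb_clique G" "card (verts G) = n" "k = hom_count H G"
      by blast
    then have fin: "finite (verts G)" by (simp add: is_rb_clique_def is_rb_graph_def)
    have "hom_count H G \<le> card (verts H \<rightarrow>\<^sub>E verts G)"
      unfolding hom_count_def using assms fin by (intro card_mono finite_PiE) auto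
    then show "k \<in> {..n ^ card (verts H)}"
      using assms G by (simp add: card_PiE)
  qed
qed simp

lemma max_count_attained:
  assumes "finite (verts H)"
  obtains G :: "nat rb_graph" where
    "is_rb_clique G" "card (verts G) = n" "max_count H n = hom_count H G"
proof -
  have "max_count H n \<in> {hom_count H G |G :: nat rb_graph. is_rb_clique G \<and> card (verts G) = n}"
    unfolding max_count_def
    by (rule Max_in[OF finite_hom_counts[OF assms]])
      (use sum_graph_clique[of 0 n] card_lessThan[of n] in fastforce)
  then show thesis using that by blast
qed

lemma hom_count_le_max_count:
  assumes "finite (verts H)" "is_rb_clique (G :: nat rb_graph)" "card (verts G) = n"
  shows "hom_count H G \<le> max_count H n"
  unfolding max_count_def by (rule Max_ge[OF finite_hom_counts[OF assms(1)]]) (use assms in blast)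

text \<open>
  This \<open>\<beta>\<close> is the critical point of \<open>x\<^bsup>2s\<^esup>(1 - x)\<close>. The slope vanishes there, so the bound for a single
  clique does not involve its number of red edges and applies directly to a maximiser.
\<close>

lemma normalized_max_D_tendsto:
  assumes s: "s \<ge> 1" and \<beta>: "\<beta> = 2 * real s / (2 * real s + 1)"
  shows "normalized_max (D s) \<longlonglongrightarrow> \<beta> ^ (2 * s) * (1 - \<beta>)"
proof (rule tendsto_sandwich)
  have \<beta>': "1 - 1 / (2 * real s) \<le> \<beta>" "0 \<le> \<beta>" "\<beta> \<le> 1"
    using s by (simp_all add: \<beta> field_simps)
  have slope: "tangent_slope (2 * s) \<beta> = 0"
  proof -
    have "tangent_slope (2 * s) \<beta> = \<beta> ^ (2 * s - 1) * (2 * real s - (2 * real s + 1) * \<beta>)"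
      using s by (cases s) (simp_all add: tangent_slope_def algebra_simps)
    then show ?thesis by (simp add: \<beta>)
  qed
  show "normalized_count (D s) (sum_graph \<beta>) \<longlonglongrightarrow> \<beta> ^ (2 * s) * (1 - \<beta>)"
    by (intro normalized_count_D_tendsto sum_graph_asymptotically_regular s \<beta>')
  show "(\<lambda>_. \<beta> ^ (2 * s) * (1 - \<beta>)) \<longlonglongrightarrow> \<beta> ^ (2 * s) * (1 - \<beta>)" by simp
  show "\<forall>\<^sub>F n in sequentially. normalized_count (D s) (sum_graph \<beta>) n \<le> normalized_max (D s) n"
    unfolding normalized_count_def normalized_max_def
    by (intro always_eventually allI divide_right_mono of_nat_mono hom_count_le_max_count
        finite_verts_D sum_graph_clique) (simp_all add: sum_graph_clique)
  show "\<forall>\<^sub>F n in sequentially. normalized_max (D s) n \<le> \<beta> ^ (2 * s) * (1 - \<beta>)"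
    using eventually_ge_at_top[of 1]
  proof eventually_elim
    case (elim n)
    obtain G :: "nat rb_graph" where G: "is_rb_clique G" "card (verts G) = n"
      "max_count (D s) n = hom_count (D s) G"
      using max_count_attained[OF finite_verts_D] by blast
    from hom_count_D_upper[OF G(1,2) elim s \<beta>'(1)] show ?case
      by (simp add: normalized_max_def G(3) card_verts_D slope)
  qed
qed

theorem theorem1p2:
  fixes s :: nat
  assumes "s \<ge> 1"
  shows "(\<forall>\<beta>::real. 1 - 1 / (2 * real s) \<le> \<beta> \<and> \<beta> \<le> 1 \<longrightarrow>
            I_sup (D s) \<beta> = \<beta> ^ (2 * s) * (1 - \<beta>) \<and>
            (\<forall>G. asymptotically_regular G \<beta> \<longrightarrow>
               good (D s) G \<and> rho (D s) G = \<beta> ^ (2 * s) * (1 - \<beta>))) \<and>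
         convergent (normalized_max (D s)) \<and>
         max_density (D s) = (2 * real s) ^ (2 * s) * (2 * real s + 1) powi (- 2 * int s - 1)"
proof (intro conjI allI impI)
  fix \<beta> :: real assume \<beta>: "1 - 1 / (2 * real s) \<le> \<beta> \<and> \<beta> \<le> 1"
  then show "I_sup (D s) \<beta> = \<beta> ^ (2 * s) * (1 - \<beta>)" using I_sup_D[OF assms] by blast
  fix G assume "asymptotically_regular G \<beta>"
  with normalized_count_D_tendsto[OF assms] \<beta>
  have "normalized_count (D s) G \<longlonglongrightarrow> \<beta> ^ (2 * s) * (1 - \<beta>)" by blast
  then show "good (D s) G" "rho (D s) G = \<beta> ^ (2 * s) * (1 - \<beta>)"
    by (auto simp: good_def rho_def convergent_def dest: limI)
next
  define \<beta> where "\<beta> = 2 * real s / (2 * real s + 1)"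
  have lim: "normalized_max (D s) \<longlonglongrightarrow> \<beta> ^ (2 * s) * (1 - \<beta>)"
    using normalized_max_D_tendsto[OF assms \<beta>_def] .
  then show "convergent (normalized_max (D s))" by (auto simp: convergent_def)
  have "max_density (D s) = \<beta> ^ (2 * s) * (1 - \<beta>)"
    using lim by (simp add: max_density_def limI)
  also have "1 - \<beta> = 1 / (2 * real s + 1)" by (simp add: \<beta>_def field_simps)
  also have "\<beta> ^ (2 * s) * \<dots> = (2 * real s) ^ (2 * s) / (2 * real s + 1) ^ (2 * s + 1)"
    by (simp add: \<beta>_def power_divide)
  also have "- 2 * int s - 1 = - int (2 * s + 1)" by simp
  then have "(2 * real s + 1) powi (- 2 * int s - 1) = inverse ((2 * real s + 1) ^ (2 * s + 1))"
    by (simp only: power_int_minus power_int_of_nat)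
  then have "(2 * real s) ^ (2 * s) / (2 * real s + 1) ^ (2 * s + 1)
      = (2 * real s) ^ (2 * s) * (2 * real s + 1) powi (- 2 * int s - 1)"
    by (simp add: divide_inverse)
  finally show "max_density (D s)
      = (2 * real s) ^ (2 * s) * (2 * real s + 1) powi (- 2 * int s - 1)" .
qed

end
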